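(* Let $p(z)=a_0z^n+a_1z^{n-1}+\cdots+a_n$ and $q(z)=b_0z^n+b_1z^{n-1}+\cdots+b_n$ be polynomials with real coefficients, $a_0>0$, and suppose that the rational function $R=q/p$ is an $R$-function of negative type with exactly $n$ poles (equivalently, $p$ and $q$ are coprime). Then the number of positive poles of $R$ equals $V^-(a_0,a_1,\ldots,a_n)$, the number of strong sign changes in the sequence of coefficients of $p$. In particular, $R$ has only negative poles if and only if $a_j>0$ for $j=1,2,\ldots,n$, and $R$ has only positive poles if and only if $a_{j-1}a_j<0$ for $j=1,2,\ldots,n$.
   Context: A real rational function $R$ is an $R$-function of negative type if for every $z$ with $\operatorname{Im} z>0$, $z$ is not a pole of $R$ and $\operatorname{Im} R(z)<0$. Poles are counted with multiplicities. For a real sequence $(a_0,\ldots,a_n)$, the number of strong sign changes $V^-(a_0,\ldots,a_n)$ is the number of sign changes (pairs of consecutive terms with negative product) in the sequence obtained by deleting all zero terms. *)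

theory Defs
  imports "HOL-Complex_Analysis.Complex_Analysis"
begin

text \<open>
  The rational function \<open>q / p\<close>. Using \<^const>\<open>remove_sings\<close> means that \<open>q / p\<close> and its reduced
  form are the same function; at a pole it has the dummy value 0, so poles must always be
  recognised by \<^const>\<open>is_pole\<close>.
\<close>
definition rational_fun :: "real poly \<Rightarrow> real poly \<Rightarrow> complex \<Rightarrow> complex" where
  "rational_fun q p =
     remove_sings (\<lambda>z. poly (map_poly of_real q) z / poly (map_poly of_real p) z)"

definition real_rational :: "(complex \<Rightarrow> complex) \<Rightarrow> bool" where
  "real_rational R \<longleftrightarrow> (\<exists>q p. p \<noteq> 0 \<and> R = rational_fun q p)"

definition R_function_negative_type :: "(complex \<Rightarrow> complex) \<Rightarrow> bool" where
  "R_function_negative_type R \<longleftrightarrow>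
     real_rational R \<and> (\<forall>z. Im z > 0 \<longrightarrow> \<not> is_pole R z \<and> Im (R z) < 0)"

text \<open>
  The number of poles in \<open>A\<close>, counted with multiplicity. The order of a pole is \<open>- zorder R z\<close>.
  This is meant for functions with finitely many poles, such as rational functions.
\<close>
definition num_poles :: "(complex \<Rightarrow> complex) \<Rightarrow> complex set \<Rightarrow> nat" where
  "num_poles R A = (\<Sum>z\<in>{z\<in>A. is_pole R z}. nat (- zorder R z))"

definition strong_sign_changes :: "real list \<Rightarrow> nat" where
  "strong_sign_changes xs =
     (let ys = filter (\<lambda>x. x \<noteq> 0) xs
      in card {i. Suc i < length ys \<and> ys ! i * ys ! Suc i < 0})"

end

theory Submission
  imports
    Defs
    "HOL-Computational_Algebra.Computational_Algebra"
    "HOL-Computational_Algebra.Field_as_Ring"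
begin

text \<open>
  When \<open>p\<close> and \<open>q\<close> are coprime, the poles of \<open>R\<close> are the roots of \<open>p\<close>, with the same
  multiplicities. There are none in the open upper half plane, and \<open>p\<close> has real coefficients,
  so \<open>p\<close> is real-rooted. For a real-rooted polynomial, Descartes' bound is an equality: let
  \<open>V\<close> and \<open>W\<close> be the numbers of sign changes of \<open>p(x)\<close> and \<open>p(-x)\<close>. A factor \<open>x - r\<close> with
  \<open>r > 0\<close> increases \<open>V\<close>, and one with \<open>r < 0\<close> increases \<open>W\<close>, so \<open>V\<close> and \<open>W\<close> are at least the
  numbers of positive and negative roots. On the other hand \<open>V + W\<close> is at most the degree
  minus the multiplicity of the root 0, which is exactly the number of nonzero roots.
\<close>

subsection \<open>Sign changes of real-rooted polynomials\<close>

text \<open>The argument \<open>s\<close> is the last nonzero term read so far, or 0 at the start.\<close>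
fun sign_changes_from :: "real \<Rightarrow> real list \<Rightarrow> nat" where
  "sign_changes_from s [] = 0"
| "sign_changes_from s (x # xs) =
     (if x = 0 then sign_changes_from s xs
      else of_bool (s * x < 0) + sign_changes_from x xs)"

section \<open>Counting sign changes recursively\<close>

lemma sign_changes_from_filter:
  "sign_changes_from s (filter (\<lambda>x. x \<noteq> 0) xs) = sign_changes_from s xs"
  by (induction xs arbitrary: s) auto

lemma card_sign_changes_Cons:
  fixes x :: real
  assumes "0 \<notin> set xs"
  shows "card {i. Suc i < length (x # xs) \<and> (x # xs) ! i * (x # xs) ! Suc i < 0} =
    sign_changes_from x xs"
  using assms
proof (induction xs arbitrary: x)
  case (Cons y ys)
  let ?A = "{i. Suc i < length (y # ys) \<and> (y # ys) ! i * (y # ys) ! Suc i < 0}"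
  let ?B = "{i. Suc i < length (x # y # ys) \<and> (x # y # ys) ! i * (x # y # ys) ! Suc i < 0}"
  have B: "?B = (if x * y < 0 then {0} else {}) \<union> Suc ` ?A"
  proof (rule set_eqI)
    fix i show "i \<in> ?B \<longleftrightarrow> i \<in> (if x * y < 0 then {0} else {}) \<union> Suc ` ?A"
      by (cases i) auto
  qed
  have "finite ?A"
    by (rule finite_subset[of _ "{..<length (y # ys)}"]) auto
  then have "card ?B = of_bool (x * y < 0) + card ?A"
    unfolding B by (subst card_Un_disjoint) (auto simp: card_image)
  with Cons show ?case by simp
qed simp

lemma strong_sign_changes_eq: "strong_sign_changes xs = sign_changes_from 0 xs"
proof (cases "filter (\<lambda>x. x \<noteq> 0) xs")
  case Nil
  then show ?thesis
    using sign_changes_from_filter[of 0 xs] by (simp add: strong_sign_changes_def)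
next
  case (Cons y ys)
  then have "y \<noteq> 0" "0 \<notin> set ys"
    by (auto simp: filter_eq_Cons_iff)
  with Cons card_sign_changes_Cons[of ys y] sign_changes_from_filter[of 0 xs]
  show ?thesis by (simp add: strong_sign_changes_def)
qed

text \<open>For \<open>n > 0\<close>, \<open>n\<close> changes require \<open>n + 1\<close> nonzero
  terms, so no term was deleted and every adjacent pair changes sign. This yields the criterion for
  positive poles.\<close>

lemma strong_sign_changes_eq_length_iff:
  assumes "length xs = Suc n"
  shows "strong_sign_changes xs = n \<longleftrightarrow> (\<forall>i<n. xs ! i * xs ! Suc i < 0)"
proof
  assume *: "\<forall>i<n. xs ! i * xs ! Suc i < 0"
  show "strong_sign_changes xs = n"
  \<comment> \<open>A single term lies in no product and may be zero, so the argument that nothing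
    is deleted needs \<open>n > 0\<close>.\<close>
  proof (cases "n = 0")
    case True
    with assms show ?thesis
      by (auto simp: strong_sign_changes_def length_Suc_conv)
  next
    case False
    have "xs ! i \<noteq> 0" if "i < Suc n" for i
      using *[rule_format, of i] *[rule_format, of "i - 1"] that False
      by (cases i; cases "i < n") auto
    then have "filter (\<lambda>x. x \<noteq> 0) xs = xs"
      using assms by (auto simp: filter_id_conv in_set_conv_nth)
    moreover have "{i. Suc i < length xs \<and> xs ! i * xs ! Suc i < 0} = {..<n}"
      using * assms by auto
    ultimately show ?thesis
      by (simp add: strong_sign_changes_def)
  qed
next
  assume *: "strong_sign_changes xs = n"
  define ys where "ys = filter (\<lambda>x. x \<noteq> 0) xs"
  define I where "I = {i. Suc i < length ys \<and> ys ! i * ys ! Suc i < 0}"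
  have card_I: "card I = n"
    using * by (simp add: strong_sign_changes_def Let_def I_def ys_def)
  show "\<forall>i<n. xs ! i * xs ! Suc i < 0"
  proof (cases "n = 0")
    case False
    have "I \<subseteq> {..<length ys - 1}"
      by (auto simp: I_def)
    from card_mono[OF _ this] have len: "length ys = Suc n"
      using card_I False assms length_filter_le[of "\<lambda>x. x \<noteq> 0" xs] by (simp add: ys_def)
    then have "ys = xs"
      using assms unfolding ys_def by (metis filter_id_conv length_filter_less nat_neq_iff)
    moreover have "I = {..<n}"
      using len card_I by (intro card_subset_eq) (auto simp: I_def)
    ultimately show ?thesis
      by (auto simp: I_def)
  qed simp
qed

lemma sign_changes_from_nonneg:
  "s \<ge> 0 \<Longrightarrow> \<forall>x\<in>set xs. x \<ge> 0 \<Longrightarrow> sign_changes_from s xs = 0"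
  by (induction xs arbitrary: s) (auto simp: not_less)

lemma sign_changes_from_append_zeros:
  "sign_changes_from s (xs @ replicate k 0) = sign_changes_from s xs"
proof (induction xs arbitrary: s)
  case Nil
  show ?case by (induction k) auto
qed simp

lemma sign_changes_from_uminus:
  "sign_changes_from s (map uminus xs) = sign_changes_from (- s) xs"
  by (induction xs arbitrary: s) auto

text \<open>On coefficients with the leading one first, this is the substitution of
  \<open>-x\<close> for \<open>x\<close>, up to a global sign that does not affect sign
  changes.\<close>

fun alternate :: "real list \<Rightarrow> real list" where
  "alternate [] = []"
| "alternate (x # xs) = x # map uminus (alternate xs)"

text \<open>
  The signs in \<open>alternate xs\<close> start with \<open>+\<close>, so a nonzero term just before \<open>xs\<close> was negated there,
  and \<open>s t < 0\<close>; then exactly one of the two sequences changes sign at the next nonzero term.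
  After an odd number of zeros \<open>s t > 0\<close>, and both or neither change; the extra change is paid
  for by the zeros.
\<close>
lemma sign_changes_from_alternate_le:
  assumes "s \<noteq> 0" "t \<noteq> 0"
  shows "sign_changes_from s xs + sign_changes_from t (alternate xs)
    \<le> length xs + of_bool (s * t > 0)"
  using assms
proof (induction xs arbitrary: s t)
  case (Cons x xs)
  show ?case
  proof (cases "x = 0")
    case True
    moreover have "s * t < 0 \<longleftrightarrow> \<not> s * t > 0"
      using Cons.prems by (auto simp: mult_less_0_iff zero_less_mult_iff)
    ultimately show ?thesis
      using Cons.IH[of s "- t"] Cons.prems
      by (auto simp: sign_changes_from_uminus split: if_splits)
  next
    case False
    then have "\<not> (s * x < 0 \<and> t * x < 0 \<and> \<not> s * t > 0)"
      by (auto simp: mult_less_0_iff zero_less_mult_iff)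
    moreover have "\<not> x * x < 0" by (simp add: not_less)
    ultimately show ?thesis
      using Cons.IH[of x "- x"] False
      by (auto simp: sign_changes_from_uminus)
  qed
qed simp

text \<open>
  Polynomials are represented by their coefficients with the leading one first. Then
  \<open>shift_diff r 0\<close> is multiplication by \<open>x - r\<close>; in general \<open>p\<close> is the coefficient preceding \<open>xs\<close>.
\<close>
definition shift_diff :: "real \<Rightarrow> real \<Rightarrow> real list \<Rightarrow> real list" where
  "shift_diff r p xs = map2 (\<lambda>x y. x - r * y) (xs @ [0]) (p # xs)"

lemma shift_diff_Nil [simp]: "shift_diff r p [] = [- (r * p)]"
  by (simp add: shift_diff_def)

lemma shift_diff_Cons [simp]: "shift_diff r p (x # xs) = (x - r * p) # shift_diff r x xs"
  by (simp add: shift_diff_def)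

lemma shift_diff_uminus: "shift_diff r (- p) (map uminus xs) = map uminus (shift_diff r p xs)"
  by (induction xs arbitrary: p) auto

text \<open>Replacing \<open>x\<close> by \<open>-x\<close> turns a factor \<open>x - r\<close> into
  \<open>x + r\<close> up to sign, so negative roots reduce to the case of positive ones.\<close>

lemma alternate_shift_diff: "alternate (shift_diff r p xs) = shift_diff (- r) (- p) (alternate xs)"
proof (induction xs arbitrary: p)
  case (Cons x xs)
  have "map uminus (shift_diff (- r) (- x) (alternate xs)) = shift_diff (- r) x (map uminus (alternate xs))"
    using shift_diff_uminus[of "- r" "- x" "alternate xs"] by simp
  with Cons show ?case by simp
qed simp

text \<open>
  Here \<open>u\<close> and \<open>s\<close> are the last nonzero terms of \<open>f\<close> and of \<open>(x - r) f\<close>, and \<open>p\<close> is the last term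
  of \<open>f\<close>: a zero term in \<open>f\<close> directly after \<open>u\<close> produces the term \<open>- r u\<close>, so \<open>s u < 0\<close> if \<open>p = 0\<close>.
  Whenever \<open>f\<close> changes sign, \<open>(x - r) f\<close> has the sign of the new term of \<open>f\<close>, and at the end the
  opposite of the sign of the last nonzero term.
\<close>
lemma sign_changes_from_shift_diff:
  assumes "r > 0" "s \<noteq> 0" "u \<noteq> 0" and "p = u \<or> p = 0 \<and> s * u < 0"
  shows "sign_changes_from s (shift_diff r p xs) \<ge> sign_changes_from u xs + of_bool (s * u > 0)"
  using assms(2-)
proof (induction xs arbitrary: s u p)
  case Nil
  then show ?case
    using \<open>r > 0\<close> by (auto simp: mult_less_0_iff zero_less_mult_iff)
next
  case (Cons x xs)
  let ?y = "x - r * p"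
  note signs = mult_less_0_iff zero_less_mult_iff
  show ?case
  proof (cases "x = 0")
    case True
    show ?thesis
    proof (cases "p = 0")
      case True
      with \<open>x = 0\<close> Cons.IH[of s u 0] Cons.prems show ?thesis by auto
    next
      case False
      with Cons.prems have "p = u" by auto
      then have "?y \<noteq> 0" "?y * u < 0"
        using True \<open>r > 0\<close> Cons.prems by (auto simp: signs)
      moreover have "s * ?y < 0 \<longleftrightarrow> s * u > 0"
        using \<open>?y * u < 0\<close> by (auto simp: signs)
      ultimately show ?thesis
        using Cons.IH[of ?y u 0] Cons.prems True by auto
    qed
  next
    case False
    show ?thesis
    proof (cases "u * x < 0 \<or> p = 0")
      case True
      have "?y * x > 0"
      proof (cases "p = 0")
        case False
        with True Cons.prems have "p = u" "p * x < 0" by auto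
        then have "r * p * x < 0" using \<open>r > 0\<close> by (simp add: signs mult.assoc)
        moreover have "x * x > 0" using \<open>x \<noteq> 0\<close> by (auto simp: signs)
        ultimately show ?thesis by (simp add: algebra_simps)
      qed (use False in \<open>auto simp: signs\<close>)
      moreover from this have "s * ?y < 0 \<longleftrightarrow> s * x < 0"
        by (auto simp: signs)
      \<comment> \<open>The 1 is the surplus \<open>of_bool (?y * x > 0)\<close> from the induction
        hypothesis. If \<open>u * x < 0\<close> and \<open>s * u > 0\<close> both hold, then
        \<open>s * x < 0\<close>.\<close>
      moreover have "of_bool (s * x < 0) + 1 \<ge> (of_bool (u * x < 0) + of_bool (s * u > 0) :: nat)"
        using True Cons.prems False by (auto simp: signs of_bool_def)
      ultimately show ?thesis
        using Cons.IH[of ?y x x] False by (auto split: if_splits)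
    next
      case ux: False
      with Cons.prems False have [simp]: "p = u" and ux: "u * x > 0"
        by (auto simp: signs)
      have sux: "s * u > 0 \<longleftrightarrow> s * x > 0" "\<not> u * x < 0"
        using ux by (auto simp: signs)
      show ?thesis
      proof (cases "?y = 0")
        case True
        then show ?thesis
          using Cons.IH[of s x x] Cons.prems False sux by auto
      next
        case y: False
        have "of_bool (s * ?y < 0) + of_bool (?y * x > 0) \<ge> (of_bool (s * x > 0) :: nat)"
          using y Cons.prems False by (auto simp: signs)
        then show ?thesis
          using Cons.IH[of ?y x x] y False sux by auto
      qed
    qed
  qed
qed

text \<open>Both lists start with the same nonzero term, so \<open>s = u\<close> there and the bonus
  \<open>of_bool (s * u > 0)\<close> is the additional change.\<close>

lemma sign_changes_shift_diff:
  assumes "r > 0" "xs \<noteq> []" "hd xs \<noteq> 0"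
  shows "sign_changes_from 0 (shift_diff r 0 xs) \<ge> Suc (sign_changes_from 0 xs)"
proof -
  have "hd xs * hd xs > 0"
    using assms by (auto simp: zero_less_mult_iff)
  with sign_changes_from_shift_diff[OF assms(1,3,3), of "hd xs" "tl xs"] assms
  show ?thesis by (cases xs) auto
qed

lemma length_shift_diff [simp]: "length (shift_diff r p xs) = Suc (length xs)"
  by (simp add: shift_diff_def)

lemma nth_shift_diff:
  "i \<le> length xs \<Longrightarrow>
    shift_diff r p xs ! i = (if i < length xs then xs ! i else 0) - r * (p # xs) ! i"
  by (simp add: shift_diff_def nth_append)

section \<open>From coefficient lists back to products of linear factors\<close>

lemma rev_coeffs_linear_mult:
  assumes "f \<noteq> 0"
  shows "rev (coeffs ([:- r, 1:] * f)) = shift_diff r 0 (rev (coeffs f))"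
proof (rule nth_equalityI)
  have ne: "[:- r, 1:] * f \<noteq> 0" using assms by (simp del: mult_pCons_left)
  have deg: "degree ([:- r, 1:] * f) = Suc (degree f)"
    using assms by (subst degree_mult_eq) auto
  show "length (rev (coeffs ([:- r, 1:] * f))) = length (shift_diff r 0 (rev (coeffs f)))"
    using ne deg assms by (simp add: length_coeffs del: mult_pCons_left)
  fix i assume "i < length (rev (coeffs ([:- r, 1:] * f)))"
  then have i: "i \<le> Suc (degree f)"
    using ne deg by (simp add: length_coeffs del: mult_pCons_left)
  have nth: "rev (coeffs g) ! j = coeff g (degree g - j)" if "g \<noteq> 0" "j \<le> degree g" for g :: "real poly" and j
    using that by (simp add: rev_nth length_coeffs coeffs_nth)
  show "rev (coeffs ([:- r, 1:] * f)) ! i = shift_diff r 0 (rev (coeffs f)) ! i"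
  proof (cases i)
    case 0
    then show ?thesis
      using assms i nth[OF ne, unfolded deg, OF i]
      by (simp add: nth_shift_diff length_coeffs nth coeff_eq_0 del: mult_pCons_left) (simp add: coeff_eq_0)
  next
    case (Suc k)
    with i have k: "k \<le> degree f" by simp
    \<comment> \<open>The case \<open>k = degree f\<close> is the constant term, to which
      \<open>x * f\<close> contributes nothing; it matches the 0 appended in
      \<open>shift_diff\<close>.\<close>
    have "coeff ([:- r, 1:] * f) (degree f - k) =
        (if k < degree f then coeff f (degree f - Suc k) else 0) - r * coeff f (degree f - k)"
      by (cases "degree f - k") (auto simp: coeff_pCons intro!: arg_cong[of _ _ "coeff f"])
    then show ?thesis
      using assms k nth[OF ne, unfolded deg, OF i] Suc
      by (simp add: nth_shift_diff length_coeffs nth del: mult_pCons_left)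
  qed
qed

lemma hd_rev_coeffs: "f \<noteq> 0 \<Longrightarrow> hd (rev (coeffs f)) = lead_coeff f"
  by (simp add: hd_rev last_coeffs_eq_coeff_degree)

text \<open>Each factor adds at least one change. The arbitrary cofactor \<open>g\<close> absorbs
  the roots of the other sign and the leading coefficient.\<close>

lemma sign_changes_prod_ge:
  assumes "\<forall>r\<in>#M. r > 0" "g \<noteq> 0"
  shows "sign_changes_from 0 (rev (coeffs ((\<Prod>r\<in>#M. [:- r, 1:]) * g))) \<ge> size M"
  using assms(1)
proof (induction M)
  case (add r M)
  let ?f = "(\<Prod>r\<in>#M. [:- r, 1:]) * g"
  have f: "?f \<noteq> 0" using assms by (auto simp: prod_mset_zero_iff)
  have "Suc (sign_changes_from 0 (rev (coeffs ?f))) \<le> sign_changes_from 0 (rev (coeffs ([:- r, 1:] * ?f)))"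
    unfolding rev_coeffs_linear_mult[OF f]
    by (rule sign_changes_shift_diff) (use add.prems f in \<open>auto simp: hd_rev_coeffs\<close>)
  with add show ?case by (simp add: mult.assoc del: mult_pCons_left)
qed simp

lemma sign_changes_alternate_prod_ge:
  assumes "\<forall>r\<in>#M. r < 0" "g \<noteq> 0"
  shows "sign_changes_from 0 (alternate (rev (coeffs ((\<Prod>r\<in>#M. [:- r, 1:]) * g)))) \<ge> size M"
  using assms(1)
proof (induction M)
  case (add r M)
  let ?f = "(\<Prod>r\<in>#M. [:- r, 1:]) * g"
  have f: "?f \<noteq> 0" using assms by (auto simp: prod_mset_zero_iff)
  obtain x xs where xs: "rev (coeffs ?f) = x # xs" "x \<noteq> 0"
    using f hd_rev_coeffs[OF f] by (cases "rev (coeffs ?f)") auto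
  have "Suc (sign_changes_from 0 (alternate (rev (coeffs ?f))))
      \<le> sign_changes_from 0 (alternate (rev (coeffs ([:- r, 1:] * ?f))))"
    unfolding rev_coeffs_linear_mult[OF f] alternate_shift_diff minus_zero
    by (rule sign_changes_shift_diff) (use add.prems xs in auto)
  with add show ?case by (simp add: mult.assoc del: mult_pCons_left)
qed simp

lemma rev_coeffs_monom_mult:
  fixes g :: "'a :: {comm_semiring_1} poly"
  assumes "g \<noteq> 0"
  shows "rev (coeffs (monom 1 k * g)) = rev (coeffs g) @ replicate k 0"
proof (induction k)
  case (Suc k)
  have "rev (coeffs (pCons 0 (monom 1 k * g))) = rev (coeffs (monom 1 k * g)) @ [0]"
    using Suc assms by (cases "monom 1 k * g = 0") auto
  with Suc show ?case
    by (simp add: monom_Suc replicate_append_same)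
qed simp

lemma degree_prod_linear: "degree (\<Prod>r\<in>#M. [:- r, 1 :: 'a :: idom:]) = size M"
proof (induction M)
  case (add r M)
  have "(\<Prod>r\<in>#M. [:- r, 1:]) \<noteq> 0"
    by (auto simp: prod_mset_zero_iff)
  with add show ?case
    using degree_mult_eq[of "[:- r, 1:]" "\<Prod>r\<in>#M. [:- r, 1:]"] by (simp del: mult_pCons_left)
qed simp

lemma sign_changes_real_rooted:
  fixes M :: "real multiset"
  assumes p: "p = smult c (\<Prod>r\<in>#M. [:- r, 1:])" and "c \<noteq> 0"
  shows "strong_sign_changes (rev (coeffs p)) = size {#r \<in># M. r > 0#}"
proof -
  let ?L = "\<lambda>M. \<Prod>r\<in>#M. [:- r, 1 :: real:]"
  define P N k where "P = {#r \<in># M. r > 0#}" and "N = {#r \<in># M. r < 0#}" and "k = count M 0"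
  \<comment> \<open>The root 0 is split off: it only appends zeros, which leave the sign changes
    alone but would weaken the upper bound by length.\<close>
  have "M = P + N + replicate_mset k 0"
    by (rule multiset_eqI) (auto simp: P_def N_def k_def)
  then have p': "p = smult c (?L P * ?L N * monom 1 k)"
    by (simp add: p monom_altdef)
  define g where "g = smult c (?L P * ?L N)"
  have L0: "?L M' \<noteq> 0" for M' by (auto simp: prod_mset_zero_iff)
  have g0: "g \<noteq> 0" using L0 \<open>c \<noteq> 0\<close> by (simp add: g_def)
  have deg: "degree g = size P + size N"
    using \<open>c \<noteq> 0\<close> L0 by (simp add: g_def degree_mult_eq degree_prod_linear)
  have "rev (coeffs p) = rev (coeffs g) @ replicate k 0"
    using rev_coeffs_monom_mult[OF g0, of k] by (simp add: p' g_def mult.commute)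
  then have V: "strong_sign_changes (rev (coeffs p)) = sign_changes_from 0 (rev (coeffs g))"
    by (simp add: strong_sign_changes_eq sign_changes_from_append_zeros)
  have "sign_changes_from 0 (rev (coeffs g)) \<ge> size P"
    using sign_changes_prod_ge[of P "smult c (?L N)"] L0 \<open>c \<noteq> 0\<close> by (simp add: g_def P_def)
  moreover have "sign_changes_from 0 (alternate (rev (coeffs g))) \<ge> size N"
    using sign_changes_alternate_prod_ge[of N "smult c (?L P)"] L0 \<open>c \<noteq> 0\<close>
    by (simp add: g_def N_def mult.commute)
  moreover obtain x xs where xs: "rev (coeffs g) = x # xs" "x \<noteq> 0"
    using g0 hd_rev_coeffs[OF g0] by (cases "rev (coeffs g)") auto
  have "length xs = degree g"
    using arg_cong[OF xs(1), of length] g0 by (simp add: length_coeffs)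
  \<comment> \<open>After the common head \<open>x\<close>, the second count is that of
    \<open>alternate xs\<close> started at \<open>- x\<close>. As \<open>x * (- x) < 0\<close>, the
    upper bound is exactly \<open>length xs\<close>.\<close>
  with xs deg have "sign_changes_from 0 (rev (coeffs g)) + sign_changes_from 0 (alternate (rev (coeffs g)))
      \<le> size P + size N"
    using sign_changes_from_alternate_le[of x "- x" xs]
    by (simp add: sign_changes_from_uminus not_less)
  ultimately show ?thesis
    by (simp add: V P_def)
qed


subsection \<open>Poles of rational functions\<close>

abbreviation complex_poly :: "real poly \<Rightarrow> complex poly" where
  "complex_poly \<equiv> map_poly of_real"

lemma complex_poly_eq_0_iff [simp]: "complex_poly p = 0 \<longleftrightarrow> p = 0"
  by (rule map_poly_eq_0_iff) auto

lemma degree_complex_poly [simp]: "degree (complex_poly p) = degree p"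
  by (rule degree_map_poly) auto

lemma complex_poly_mult: "complex_poly (p * q) = complex_poly p * complex_poly q"
  by (rule poly_eqI) (simp add: coeff_map_poly coeff_mult)

lemma complex_poly_add: "complex_poly (p + q) = complex_poly p + complex_poly q"
  by (rule poly_eqI) (simp add: coeff_map_poly)

lemma complex_poly_smult: "complex_poly (smult c p) = smult (of_real c) (complex_poly p)"
  by (rule poly_eqI) (simp add: coeff_map_poly)

lemma inj_complex_poly: "inj complex_poly"
proof (rule injI, rule poly_eqI)
  fix p q n assume "complex_poly p = complex_poly q"
  then have "coeff (complex_poly p) n = coeff (complex_poly q) n" by simp
  then show "coeff p n = coeff q n" by (simp add: coeff_map_poly)
qed

lemma poly_complex_poly_cnj: "poly (complex_poly p) (cnj z) = cnj (poly (complex_poly p) z)"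
  by (induction p) (auto simp: map_poly_pCons)

text \<open>Bezout's identity excludes common roots; conversely, a common divisor that is not a unit
  has a complex root.\<close>

lemma coprime_iff_no_common_complex_root:
  fixes p q :: "real poly"
  assumes "p \<noteq> 0"
  shows "coprime p q \<longleftrightarrow> (\<forall>z. \<not> (poly (complex_poly p) z = 0 \<and> poly (complex_poly q) z = 0))"
proof
  assume "coprime p q"
  then obtain u v where uv: "u * p + v * q = 1"
    using bezout_coefficients_fst_snd[of p q] coprime_imp_gcd_eq_1[of p q] by auto
  have *: "complex_poly u * complex_poly p + complex_poly v * complex_poly q = 1"
    using arg_cong[OF uv, of complex_poly]
    by (simp add: complex_poly_add complex_poly_mult)
  have one: "poly (complex_poly u) z * poly (complex_poly p) z +
      poly (complex_poly v) z * poly (complex_poly q) z = 1" for z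
    using arg_cong[OF *, of "\<lambda>f. poly f z"] by simp
  then show "\<forall>z. \<not> (poly (complex_poly p) z = 0 \<and> poly (complex_poly q) z = 0)"
    by (metis one add.right_neutral mult_zero_right zero_neq_one)
next
  assume *: "\<forall>z. \<not> (poly (complex_poly p) z = 0 \<and> poly (complex_poly q) z = 0)"
  show "coprime p q"
  proof (rule ccontr)
    assume "\<not> coprime p q"
    then obtain g where g: "g dvd p" "g dvd q" "\<not> is_unit g"
      by (auto simp: coprime_def)
    with assms have "degree g \<noteq> 0" by (auto simp: is_unit_iff_degree)
    then have "\<not> constant (poly (complex_poly g))"
      by (simp add: constant_degree)
    then obtain z where "poly (complex_poly g) z = 0"
      using fundamental_theorem_of_algebra by blast
    with g have "poly (complex_poly p) z = 0" "poly (complex_poly q) z = 0"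
      by (auto simp: dvd_def complex_poly_mult)
    with * show False by blast
  qed
qed

text \<open>Taking \<open>Re\<close> loses nothing on real roots, and the complex factorization
  descends to the reals because \<open>complex_poly\<close> is injective.\<close>

lemma proots_complex_poly_real_rooted:
  assumes real: "\<And>z. poly (complex_poly p) z = 0 \<Longrightarrow> z \<in> \<real>" and "p \<noteq> 0"
  obtains M where "p = smult (lead_coeff p) (\<Prod>r\<in>#M. [:- r, 1:])"
    and "proots (complex_poly p) = image_mset of_real M"
proof
  define M where "M = image_mset Re (proots (complex_poly p))"
  have "image_mset of_real M = image_mset (\<lambda>z. z) (proots (complex_poly p))"
    unfolding M_def multiset.map_comp
    by (rule image_mset_cong) (use assms in \<open>auto elim!: Reals_cases\<close>)
  then show M: "proots (complex_poly p) = image_mset of_real M" by simp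
  have "complex_poly (\<Prod>r\<in>#M'. [:- r, 1:]) = (\<Prod>r\<in>#M'. [:- of_real r, 1:])" for M'
    by (induction M') (simp_all add: complex_poly_mult map_poly_pCons del: mult_pCons_left)
  then have "complex_poly (smult (lead_coeff p) (\<Prod>r\<in>#M. [:- r, 1:])) =
      smult (lead_coeff (complex_poly p)) (\<Prod>z\<in>#proots (complex_poly p). [:- z, 1:])"
    unfolding M by (simp add: complex_poly_smult multiset.map_comp o_def coeff_map_poly)
  also have "\<dots> = complex_poly p"
    by (rule complex_poly_decompose_multiset)
  finally show "p = smult (lead_coeff p) (\<Prod>r\<in>#M. [:- r, 1:])"
    using inj_complex_poly by (auto simp: inj_def)
qed

section \<open>Zeros and poles of quotients of polynomials\<close>

lemma analytic_on_poly: "poly (P :: complex poly) analytic_on A"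
proof -
  have "poly P analytic_on UNIV"
    by (subst analytic_on_open) (auto intro: holomorphic_intros)
  then show ?thesis by (rule analytic_on_subset) simp
qed

text \<open>Once the powers of \<open>w - z\<close> are split off, the remaining quotient is
  holomorphic and nonzero near \<open>z\<close>.\<close>

lemma zorder_poly_divide:
  fixes P Q :: "complex poly"
  assumes "P \<noteq> 0" "Q \<noteq> 0"
  shows "zorder (\<lambda>z. poly Q z / poly P z) z = int (order z Q) - int (order z P)"
proof -
  define k m where "k = order z Q" and "m = order z P"
  obtain P1 where P1: "P = [:- z, 1:] ^ m * P1" "\<not> [:- z, 1:] dvd P1"
    using order_decomp[OF assms(1)] unfolding m_def by blast
  obtain Q1 where Q1: "Q = [:- z, 1:] ^ k * Q1" "\<not> [:- z, 1:] dvd Q1"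
    using order_decomp[OF assms(2)] unfolding k_def by blast
  have "zorder (\<lambda>z. poly Q z / poly P z) z = int k - int m"
  proof (rule zorder_eqI)
    show "open {w. poly P1 w \<noteq> 0}"
      by (intro open_Collect_neq continuous_intros)
    show "(\<lambda>w. poly Q1 w / poly P1 w) holomorphic_on {w. poly P1 w \<noteq> 0}"
      by (intro holomorphic_intros) auto
    show "poly Q w / poly P w = poly Q1 w / poly P1 w * (w - z) powi (int k - int m)"
      if "w \<noteq> z" for w
      using that by (simp add: P1(1) Q1(1) power_int_diff mult.commute)
  qed (use P1(2) Q1(2) in \<open>auto simp: poly_eq_0_iff_dvd\<close>)
  then show ?thesis by (simp add: k_def m_def)
qed

lemma is_pole_poly_divide_iff:
  fixes P Q :: "complex poly"
  assumes "P \<noteq> 0" "Q \<noteq> 0"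
  shows "is_pole (\<lambda>z. poly Q z / poly P z) z \<longleftrightarrow> order z Q < order z P"
proof -
  let ?f = "\<lambda>z. poly Q z / poly P z"
  have mero: "?f meromorphic_on {z}"
    by (intro meromorphic_intros analytic_on_imp_meromorphic_on analytic_on_poly)
  \<comment> \<open>A negative \<open>zorder\<close> signals a pole only if the function does not
    vanish identically near \<open>z\<close>; the finitely many roots of \<open>P * Q\<close> cannot
    accumulate there.\<close>
  have "eventually (\<lambda>z. ?f z \<noteq> 0) (at z)"
  proof -
    have "finite {w. poly (P * Q) w = 0}"
      using assms by (intro poly_roots_finite) auto
    then have "\<not> z islimpt {w. poly (P * Q) w = 0}"
      by (rule islimpt_finite)
    then have "eventually (\<lambda>w. w \<notin> {w. poly (P * Q) w = 0}) (at z)"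
      by (simp only: islimpt_iff_eventually not_not)
    then show ?thesis by eventually_elim auto
  qed
  then have "is_pole ?f z \<longleftrightarrow> zorder ?f z < 0"
    using zorder_neg_imp_is_pole[OF mero] isolated_pole_imp_neg_zorder[of ?f z] mero
    by (auto simp: meromorphic_at_iff)
  then show ?thesis
    by (simp add: zorder_poly_divide assms)
qed

lemma isolated_singularity_at_poly_divide:
  fixes P Q :: "complex poly"
  shows "isolated_singularity_at (\<lambda>z. poly Q z / poly P z) z"
proof -
  have "(\<lambda>z. poly Q z / poly P z) meromorphic_on {z}"
    by (intro meromorphic_intros analytic_on_imp_meromorphic_on analytic_on_poly)
  then show ?thesis by (simp add: meromorphic_at_iff)
qed

text \<open>All singularities are isolated, so \<open>remove_sings\<close> preserves poles and
  orders.\<close>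

lemma
  assumes "p \<noteq> 0" "q \<noteq> 0"
  shows is_pole_rational_fun_iff:
      "is_pole (rational_fun q p) z \<longleftrightarrow> order z (complex_poly q) < order z (complex_poly p)"
    and zorder_rational_fun:
      "zorder (rational_fun q p) z = int (order z (complex_poly q)) - int (order z (complex_poly p))"
  using assms unfolding rational_fun_def
  by (simp_all add: isolated_singularity_at_poly_divide is_pole_poly_divide_iff zorder_poly_divide)

lemma order_complex_poly_coprime:
  assumes "p \<noteq> 0" "q \<noteq> 0" "coprime p q" "poly (complex_poly p) z = 0"
  shows "order z (complex_poly q) = 0"
proof -
  have "poly (complex_poly q) z \<noteq> 0"
    using assms by (auto simp: coprime_iff_no_common_complex_root)
  then show ?thesis by (simp add: order_root)
qed

lemma is_pole_rational_fun_coprime_iff: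
  assumes "p \<noteq> 0" "q \<noteq> 0" "coprime p q"
  shows "is_pole (rational_fun q p) z \<longleftrightarrow> poly (complex_poly p) z = 0"
  using order_complex_poly_coprime[OF assms, of z] assms
  by (auto simp: is_pole_rational_fun_iff order_root)

text \<open>The sum may run over all roots of \<open>p\<close>: where \<open>q\<close> cancels the
  root, truncated subtraction gives 0.\<close>

lemma num_poles_rational_fun:
  assumes "p \<noteq> 0" "q \<noteq> 0"
  shows "num_poles (rational_fun q p) A =
    (\<Sum>z | z \<in> A \<and> poly (complex_poly p) z = 0. order z (complex_poly p) - order z (complex_poly q))"
  unfolding num_poles_def
proof (rule sum.mono_neutral_cong_left)
  show "finite {z. z \<in> A \<and> poly (complex_poly p) z = 0}"
    by (rule finite_subset[OF _ poly_roots_finite[of "complex_poly p"]]) (use assms in auto)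
  show "{z \<in> A. is_pole (rational_fun q p) z} \<subseteq> {z. z \<in> A \<and> poly (complex_poly p) z = 0}"
    using assms by (auto simp: is_pole_rational_fun_iff order_root)
qed (use assms in \<open>auto simp: is_pole_rational_fun_iff zorder_rational_fun\<close>)

lemma num_poles_rational_fun_coprime:
  assumes "p \<noteq> 0" "q \<noteq> 0" "coprime p q"
  shows "num_poles (rational_fun q p) A = size {#z \<in># proots (complex_poly p). z \<in> A#}"
proof -
  have set: "set_mset {#z \<in># proots (complex_poly p). z \<in> A#} = {z. z \<in> A \<and> poly (complex_poly p) z = 0}"
    using assms by auto
  show ?thesis
    unfolding num_poles_rational_fun[OF assms(1,2)] size_multiset_overloaded_eq set
    by (intro sum.cong) (use assms in \<open>auto simp: order_complex_poly_coprime\<close>)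
qed

text \<open>The orders of the roots of \<open>p\<close> add up to its degree, and a common root with
  \<open>q\<close> makes one summand strictly smaller.\<close>

lemma num_poles_rational_fun_eq_degree_iff:
  assumes "p \<noteq> 0" "q \<noteq> 0"
  shows "num_poles (rational_fun q p) UNIV = degree p \<longleftrightarrow> coprime p q"
proof
  assume "coprime p q"
  with assms show "num_poles (rational_fun q p) UNIV = degree p"
    by (simp add: num_poles_rational_fun_coprime size_proots_complex)
next
  let ?P = "complex_poly p" and ?Q = "complex_poly q"
  assume *: "num_poles (rational_fun q p) UNIV = degree p"
  have fin: "finite {z. poly ?P z = 0}"
    using assms by (intro poly_roots_finite) auto
  have deg: "degree p = (\<Sum>z | poly ?P z = 0. order z ?P)"
    using size_proots_complex[of ?P] assms by (simp add: size_multiset_overloaded_eq)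
  show "coprime p q"
  proof (rule ccontr)
    assume "\<not> coprime p q"
    then obtain z where "poly ?P z = 0" "poly ?Q z = 0"
      using assms by (auto simp: coprime_iff_no_common_complex_root)
    then have "order z ?P - order z ?Q < order z ?P"
      using assms by (simp add: order_root)
    with \<open>poly ?P z = 0\<close> have "(\<Sum>z | poly ?P z = 0. order z ?P - order z ?Q) < degree p"
      unfolding deg using fin by (intro sum_strict_mono_ex1) auto
    with * show False by (simp add: num_poles_rational_fun assms)
  qed
qed

text \<open>A root in the lower half plane would have its conjugate, also a root, in the upper
  one.\<close>

lemma R_function_negative_type_real_poles:
  assumes "R_function_negative_type (rational_fun q p)" "p \<noteq> 0" "q \<noteq> 0" "coprime p q"
    and "poly (complex_poly p) z = 0"
  shows "z \<in> \<real>"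
proof -
  have "\<not> Im w > 0" if "poly (complex_poly p) w = 0" for w
  proof
    assume "Im w > 0"
    then have "\<not> is_pole (rational_fun q p) w"
      using assms(1) by (auto simp: R_function_negative_type_def)
    with that show False
      by (simp add: is_pole_rational_fun_coprime_iff[OF assms(2-4)])
  qed
  from this[of z] this[of "cnj z"] assms(5) show ?thesis
    by (auto simp: poly_complex_poly_cnj complex_is_Real_iff)
qed

subsection \<open>Coefficients\<close>

lemma coeff_prod_linear_pos:
  fixes M :: "real multiset"
  assumes "\<forall>r\<in>#M. r < 0" "k \<le> size M"
  shows "coeff (\<Prod>r\<in>#M. [:- r, 1:]) k > 0"
  using assms
proof (induction M arbitrary: k)
  case (add r M)
  let ?f = "\<Prod>r\<in>#M. [:- r, 1 :: real:]"
  \<comment> \<open>Past the degree the coefficient is 0. This matters for the new leading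
    coefficient, whose positivity comes from the shifted term alone.\<close>
  have f: "coeff ?f i > 0 \<or> i > size M \<and> coeff ?f i = 0" for i
    using add.IH[of i] add.prems(1) by (cases "i \<le> size M") (auto intro: coeff_eq_0 simp: degree_prod_linear)
  have "coeff (\<Prod>r\<in>#add_mset r M. [:- r, 1:]) k =
      - r * coeff ?f k + (case k of 0 \<Rightarrow> 0 | Suc j \<Rightarrow> coeff ?f j)"
    by (simp add: coeff_pCons)
  moreover have "- r > 0" using add.prems by simp
  ultimately show ?case
    using f[of k] f[of "k - 1"] add.prems(2) mult_pos_pos[of "- r" "coeff ?f k"]
    by (auto split: nat.splits)
qed simp

lemma coeff_sum_monom_rev:
  fixes a :: "nat \<Rightarrow> real"
  assumes "j \<le> n"
  shows "coeff (\<Sum>i\<le>n. monom (a i) (n - i)) (n - j) = a j"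
proof -
  have "coeff (\<Sum>i\<le>n. monom (a i) (n - i)) (n - j) = (\<Sum>i\<le>n. if i = j then a i else 0)"
    unfolding coeff_sum using assms by (intro sum.cong) auto
  with assms show ?thesis by simp
qed

lemma
  fixes a :: "nat \<Rightarrow> real"
  assumes "a 0 \<noteq> 0"
  shows degree_sum_monom_rev: "degree (\<Sum>i\<le>n. monom (a i) (n - i)) = n" (is "degree ?p = n")
    and rev_coeffs_sum_monom: "rev (coeffs (\<Sum>i\<le>n. monom (a i) (n - i))) = map a [0..<Suc n]"
proof -
  have "degree ?p \<le> n"
    by (intro degree_sum_le) (auto intro: order.trans[OF degree_monom_le])
  moreover have "coeff ?p n \<noteq> 0"
    using coeff_sum_monom_rev[of 0 n a] assms by simp
  ultimately show deg: "degree ?p = n"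
    by (simp add: le_antisym le_degree)
  then have "?p \<noteq> 0"
    using \<open>coeff ?p n \<noteq> 0\<close> by force
  show "rev (coeffs ?p) = map a [0..<Suc n]"
    by (rule nth_equalityI)
      (use \<open>?p \<noteq> 0\<close> in \<open>simp_all add: length_coeffs deg rev_nth coeffs_nth coeff_sum_monom_rev del: upt_Suc\<close>)
qed

lemma size_filter_mset_eq_iff: "size (filter_mset Q M) = size M \<longleftrightarrow> (\<forall>x\<in>#M. Q x)"
proof (induction M)
  case (add x M)
  have "size (filter_mset Q M) \<noteq> Suc (size M)"
    using size_filter_mset_lesseq[of Q M] by linarith
  with add show ?case by simp
qed simp

theorem theorem3p33:
  fixes n :: nat and a b :: "nat \<Rightarrow> real" and p q :: "real poly" and R :: "complex \<Rightarrow> complex"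
  assumes p_def: "p = (\<Sum>j\<le>n. monom (a j) (n - j))"
    and q_def: "q = (\<Sum>j\<le>n. monom (b j) (n - j))"
    and a0: "a 0 > 0"
    and R_def: "R = rational_fun q p"
    and R_neg: "R_function_negative_type R"
  shows "(num_poles R UNIV = n \<longleftrightarrow> coprime p q) \<and>
    (num_poles R UNIV = n \<longrightarrow>
       num_poles R (complex_of_real ` {0<..}) = strong_sign_changes (map a [0..<Suc n]) \<and>
       ((\<forall>z. is_pole R z \<longrightarrow> z \<in> complex_of_real ` {..<0}) \<longleftrightarrow> (\<forall>j\<in>{1..n}. a j > 0)) \<and>
       ((\<forall>z. is_pole R z \<longrightarrow> z \<in> complex_of_real ` {0<..}) \<longleftrightarrow> (\<forall>j\<in>{1..n}. a (j - 1) * a j < 0)))"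
proof -
  have deg: "degree p = n" and rev_p: "rev (coeffs p) = map a [0..<Suc n]"
    using a0 by (simp_all add: p_def degree_sum_monom_rev rev_coeffs_sum_monom del: upt_Suc)
  have coeff_p: "coeff p (n - j) = a j" if "j \<le> n" for j
    using that by (simp add: p_def coeff_sum_monom_rev)
  have "p \<noteq> 0"
    using coeff_p[of 0] a0 by auto
  have "q \<noteq> 0"
  proof
    assume "q = 0"
    \<comment> \<open>Any point of the upper half plane would do: the zero function has no negative
      imaginary part there.\<close>
    then have "Im (R \<i>) = 0"
      by (simp add: R_def rational_fun_def)
    with R_neg show False
      by (auto simp: R_function_negative_type_def dest: spec[of _ \<i>])
  qed
  have iff: "num_poles R UNIV = n \<longleftrightarrow> coprime p q"
    using num_poles_rational_fun_eq_degree_iff[OF \<open>p \<noteq> 0\<close> \<open>q \<noteq> 0\<close>] by (simp add: R_def deg)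
  show ?thesis
  proof (intro conjI impI iff)
    assume "num_poles R UNIV = n"
    with iff have "coprime p q" by simp
    let ?P = "complex_poly p"
    have pole_iff: "is_pole R z \<longleftrightarrow> poly ?P z = 0" for z
      using \<open>p \<noteq> 0\<close> \<open>q \<noteq> 0\<close> \<open>coprime p q\<close>
      by (simp add: R_def is_pole_rational_fun_coprime_iff)
    have "\<And>z. poly ?P z = 0 \<Longrightarrow> z \<in> \<real>"
      using R_function_negative_type_real_poles R_neg \<open>p \<noteq> 0\<close> \<open>q \<noteq> 0\<close> \<open>coprime p q\<close>
      unfolding R_def by blast
    then obtain M where M: "p = smult (lead_coeff p) (\<Prod>r\<in>#M. [:- r, 1:])"
      and proots: "proots ?P = image_mset of_real M"
      using \<open>p \<noteq> 0\<close> proots_complex_poly_real_rooted by blast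
    have "lead_coeff p = a 0"
      using coeff_p[of 0] deg by simp
    with M have p_prod: "p = smult (a 0) (\<Prod>r\<in>#M. [:- r, 1:])" by simp
    have size_M: "size M = n"
      using size_proots_complex[of ?P] by (simp add: proots deg)
    have "is_pole R z \<longleftrightarrow> z \<in># proots ?P" for z
      using \<open>p \<noteq> 0\<close> by (simp add: pole_iff)
    then have poles: "(\<forall>z. is_pole R z \<longrightarrow> z \<in> complex_of_real ` A) \<longleftrightarrow> (\<forall>r\<in>#M. r \<in> A)" for A
      by (auto simp: proots image_iff)
    have V: "strong_sign_changes (map a [0..<Suc n]) = size {#r \<in># M. r > 0#}"
      using sign_changes_real_rooted[OF p_prod] a0 by (simp only: rev_p)
    show "num_poles R (complex_of_real ` {0<..}) = strong_sign_changes (map a [0..<Suc n])"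
      unfolding R_def V num_poles_rational_fun_coprime[OF \<open>p \<noteq> 0\<close> \<open>q \<noteq> 0\<close> \<open>coprime p q\<close>]
        proots filter_mset_image_mset
      by (simp add: image_iff)
    show "(\<forall>z. is_pole R z \<longrightarrow> z \<in> complex_of_real ` {..<0}) \<longleftrightarrow> (\<forall>j\<in>{1..n}. a j > 0)"
      unfolding poles
    proof
      assume "\<forall>r\<in>#M. r \<in> {..<0}"
      then have "a 0 * coeff (\<Prod>r\<in>#M. [:- r, 1:]) (n - j) > 0" for j
        using a0 by (intro mult_pos_pos coeff_prod_linear_pos) (auto simp: size_M)
      then have "a j > 0" if "j \<le> n" for j
        using coeff_p[OF that] by (metis coeff_smult p_prod)
      then show "\<forall>j\<in>{1..n}. a j > 0" by simp
    next
      assume "\<forall>j\<in>{1..n}. a j > 0"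
      with a0 have pos: "a j > 0" if "j \<le> n" for j
        using that by (cases "j = 0") auto
      then have "\<forall>x\<in>set (map a [0..<Suc n]). x \<ge> 0"
        by (auto intro: less_imp_le simp del: upt_Suc)
      then have "strong_sign_changes (map a [0..<Suc n]) = 0"
        unfolding strong_sign_changes_eq by (intro sign_changes_from_nonneg) auto
      then have "\<forall>r\<in>#M. \<not> r > 0"
        unfolding V by (simp add: filter_mset_eq_mempty_iff)
      \<comment> \<open>The absence of sign changes excludes only positive roots; the root 0 is
        excluded by the positive constant term \<open>a n\<close>.\<close>
      moreover have "0 \<notin># M"
      proof
        assume "0 \<in># M"
        then have "poly p 0 = 0"
          unfolding p_prod by (auto dest!: multi_member_split)
        then show False
          using coeff_p[of n] pos[of n] by (simp add: poly_0_coeff_0)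
      qed
      ultimately show "\<forall>r\<in>#M. r \<in> {..<0}"
        by (metis lessThan_iff linorder_neqE_linordered_idom)
    qed
    \<comment> \<open>All poles are positive exactly when the number of positive roots, hence of
      sign changes, attains its maximum \<open>n\<close>.\<close>
    have "(\<forall>z. is_pole R z \<longrightarrow> z \<in> complex_of_real ` {0<..}) \<longleftrightarrow> size {#r \<in># M. r > 0#} = n"
      unfolding poles using size_filter_mset_eq_iff[of "\<lambda>r. r > 0" M] size_M by simp
    also have "\<dots> \<longleftrightarrow> (\<forall>i<n. a i * a (Suc i) < 0)"
      unfolding V[symmetric] by (subst strong_sign_changes_eq_length_iff) (auto simp del: upt_Suc)
    also have "\<dots> \<longleftrightarrow> (\<forall>j\<in>{1..n}. a (j - 1) * a j < 0)"
      unfolding image_Suc_lessThan[symmetric] by auto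
    finally show "(\<forall>z. is_pole R z \<longrightarrow> z \<in> complex_of_real ` {0<..}) \<longleftrightarrow> (\<forall>j\<in>{1..n}. a (j - 1) * a j < 0)" .
  qed
qed

end
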